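(* Let $\kappa$ be a cardinal and assume $\mathsf{MA}_\kappa$. Let $K$ be a separable compact line of weight $\kappa$. Then for every countable discrete extension $L$ of $K$ there is an extension operator $E: C(K)\to C(L)$ of norm at most three, i.e. a bounded linear operator $E: C(K)\to C(L)$ with $\|E\|\leq 3$ such that $(Ef)|_K=f$ for all $f\in C(K)$.
   Context: Compact spaces are assumed to be Hausdorff. A compact line is a compact space $K$ whose topology is the order topology of some linear order on $K$. The weight of a space is the least cardinality of a base of its topology. For a compact space $K$, a compact space $L$ is a countable discrete extension of $K$ if $K$ is a (topological) subspace of $L$ and $L\setminus K$ is a countable discrete space. $C(K)$ is the Banach space of real-valued continuous functions on $K$ with the supremum norm. For compact spaces $K\subseteq L$, a bounded linear operator $E:C(K)\to C(L)$ is an extension operator if $(Ef)|_K=f$ for all $f\in C(K)$. Martin's Axiom $\mathsf{MA}_\kappa$ is the statement: for every nonempty partial order $\mathbb{P}$ satisfying the countable chain condition (every family of pairwise incompatible elements is countable) and every family $\mathcal{D}$ of at most $\kappa$ dense subsets of $\mathbb{P}$, there is a filter $G\subseteq\mathbb{P}$ with $G\cap D\neq\emptyset$ for all $D\in\mathcal{D}$. *)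

theory Defs
  imports "HOL-Analysis.Analysis"
begin

context
  includes cardinal_syntax
begin

text \<open>
  A cardinal is a relation \<open>\<kappa>\<close> with \<open>Card_order \<kappa>\<close>. The weight is characterised rather than
  returned as a value, so that \<open>\<kappa>\<close> may live on a type unrelated to the space.
\<close>

definition has_weight :: "'a::topological_space itself \<Rightarrow> 'k rel \<Rightarrow> bool" where
  "has_weight _ \<kappa> \<longleftrightarrow>
     (\<exists>B::'a set set. topological_basis B \<and> |B| =o \<kappa>) \<and>
     (\<forall>B::'a set set. topological_basis B \<longrightarrow> \<kappa> \<le>o |B| )"

text \<open>
  Forcing posets are given by a carrier \<open>P\<close> and an order relation \<open>r\<close>, where \<open>(p, q) \<in> r\<close> means
  \<open>p \<le> q\<close>, i.e. \<open>p\<close> is the stronger condition.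
\<close>

definition compatible :: "'p set \<Rightarrow> 'p rel \<Rightarrow> 'p \<Rightarrow> 'p \<Rightarrow> bool" where
  "compatible P r p q \<longleftrightarrow> (\<exists>s\<in>P. (s, p) \<in> r \<and> (s, q) \<in> r)"

definition ccc :: "'p set \<Rightarrow> 'p rel \<Rightarrow> bool" where
  "ccc P r \<longleftrightarrow> (\<forall>A\<subseteq>P. pairwise (\<lambda>p q. \<not> compatible P r p q) A \<longrightarrow> countable A)"

definition dense_in_poset :: "'p set \<Rightarrow> 'p rel \<Rightarrow> 'p set \<Rightarrow> bool" where
  "dense_in_poset P r D \<longleftrightarrow> D \<subseteq> P \<and> (\<forall>p\<in>P. \<exists>d\<in>D. (d, p) \<in> r)"

definition filter_in_poset :: "'p set \<Rightarrow> 'p rel \<Rightarrow> 'p set \<Rightarrow> bool" where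
  "filter_in_poset P r G \<longleftrightarrow>
     G \<subseteq> P \<and> G \<noteq> {} \<and>
     (\<forall>p\<in>G. \<forall>q\<in>P. (p, q) \<in> r \<longrightarrow> q \<in> G) \<and>
     (\<forall>p\<in>G. \<forall>q\<in>G. \<exists>s\<in>G. (s, p) \<in> r \<and> (s, q) \<in> r)"

text \<open>
  HOL cannot quantify over all types inside a formula, so the posets range over all sets of elements
  of the type \<open>'k\<close> that carries \<open>\<kappa>\<close>. That type is arbitrary (any cardinal can be represented on any
  sufficiently large type), and it always has at least \<open>\<kappa>\<close> elements. Nothing is lost: for infinite
  \<open>\<kappa>\<close>, Martin's Axiom for \<open>\<kappa>\<close> follows from its instances for posets with at most \<open>\<kappa>\<close> elements
  (pass to a subposet closed under witnesses for compatibility and for the given dense sets); for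
  finite \<open>\<kappa>\<close> it is provable outright.
\<close>

definition martins_axiom :: "'k rel \<Rightarrow> bool" where
  "martins_axiom \<kappa> \<longleftrightarrow>
     (\<forall>(P::'k set) (r::'k rel) (Ds::'k set set).
        P \<noteq> {} \<and> partial_order_on P r \<and> ccc P r \<and>
        (\<forall>D\<in>Ds. dense_in_poset P r D) \<and> |Ds| \<le>o \<kappa> \<longrightarrow>
        (\<exists>G. filter_in_poset P r G \<and> (\<forall>D\<in>Ds. G \<inter> D \<noteq> {})))"

end

text \<open>
  The inclusion of \<open>K\<close> into \<open>L\<close> is a topological embedding \<open>i\<close> between the types \<open>'a\<close> and \<open>'b\<close>
  that represent \<open>K\<close> and \<open>L\<close>; as usual, \<open>K\<close> is identified with \<open>range i\<close>.
\<close>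

definition countable_discrete_extension ::
    "('a::topological_space \<Rightarrow> 'b::topological_space) \<Rightarrow> bool" where
  "countable_discrete_extension i \<longleftrightarrow>
     compact (UNIV :: 'b set) \<and>
     embedding_map euclidean euclidean i \<and>
     countable (- range i) \<and> discrete (- range i)"

text \<open>
  On a compact space every continuous real function is bounded, so the Banach space \<open>C(K)\<close> is the
  library type \<open>'a \<Rightarrow>\<^sub>C real\<close> with its supremum norm, and a bounded linear operator
  \<open>C(K) \<rightarrow> C(L)\<close> is an element of \<open>('a \<Rightarrow>\<^sub>C real) \<Rightarrow>\<^sub>L ('b \<Rightarrow>\<^sub>C real)\<close> with its operator norm.
\<close>

definition extension_operator ::
    "('a::topological_space \<Rightarrow> 'b::topological_space) \<Rightarrow>
     (('a \<Rightarrow>\<^sub>C real) \<Rightarrow>\<^sub>L ('b \<Rightarrow>\<^sub>C real)) \<Rightarrow> bool" where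
  "extension_operator i E \<longleftrightarrow>
     (\<forall>f x. apply_bcontfun (blinfun_apply E f) (i x) = apply_bcontfun f x)"

end

theory Submission
  imports Defs
begin

text \<open>
  Let \<open>N\<close> be the set of points of \<open>L\<close> outside \<open>K\<close>, and let \<open>Q\<close> consist of the points of \<open>K\<close> that have
  an immediate successor, together with a countable dense set \<open>D\<close>. For each \<open>q\<close> in \<open>Q\<close> there is
  \<open>A q \<subseteq> N\<close> such that the limits in \<open>K\<close> of \<open>A q\<close> are at most \<open>q\<close> and those of \<open>N - A q\<close> at least \<open>q\<close>
  (and different from \<open>q\<close> if \<open>q\<close> has a successor); these sets increase modulo finite sets. Enumerate \<open>N\<close> by
  natural numbers. Martin's Axiom yields a rank \<open>g\<close> on \<open>Q\<close> such that, for each \<open>n\<close> in \<open>N\<close>,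
  membership of \<open>n\<close> in \<open>A q\<close>, read along those \<open>q\<close> with \<open>g q \<le> n\<close>, never runs through the pattern
  in, out, in, out. Hence it changes at most at three places \<open>a n\<close>, \<open>b n\<close>, \<open>c n\<close>, and
  \<open>E f n = f (a n) - f (b n) + f (c n)\<close> is the required operator: \<open>f\<close> nearly depends only on the position
  relative to finitely many \<open>q\<close>, and for these \<open>n\<close> close to \<open>x\<close> lies on the same side as \<open>x\<close>.

  The forcing conditions are finite approximations to the graph of \<open>g\<close>. They split into countably many
  classes of pairwise compatible ones: if two conditions are separated by the same finite subset \<open>R\<close> of \<open>D\<close>
  and look alike below some \<open>m\<close>, then above \<open>m\<close> the two families of sets switch in the same cell of \<open>R\<close>,
  which contains only one element of each.
\<close>

section \<open>The forcing notion\<close>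

context
  includes cardinal_syntax
begin

text \<open>Induction on the size: a set of \<open>n + 1\<close> elements arises from one of
  \<open>n\<close> elements by adding a point, so each size contributes at most \<open>|B|\<close>
  sets. This bounds the number of forcing conditions.\<close>

lemma card_of_finite_subsets_ordLeq_infinite:
  assumes inf: "infinite B" and le: "|A| \<le>o |B|"
  shows "|{F. finite F \<and> F \<subseteq> A}| \<le>o |B|"
proof -
  define S where "S n = {F. finite F \<and> F \<subseteq> A \<and> card F = n}" for n :: nat
  have "|S n| \<le>o |B|" for n
  proof (induction n)
    case 0
    have "S 0 = {{}}" by (auto simp: S_def)
    then show ?case using inf by (metis card_of_singl_ordLeq finite.emptyI)
  next
    case (Suc n)
    have "S (Suc n) \<subseteq> (\<lambda>(x, F). insert x F) ` (A \<times> S n)"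
    proof
      fix F assume "F \<in> S (Suc n)"
      then have F: "finite F" "F \<subseteq> A" "card F = Suc n" by (auto simp: S_def)
      then obtain x where "x \<in> F" by fastforce
      with F have "x \<in> A" "F - {x} \<in> S n" "F = insert x (F - {x})"
        by (auto simp: S_def)
      then show "F \<in> (\<lambda>(x, F). insert x F) ` (A \<times> S n)"
        by (intro image_eqI[of _ _ "(x, F - {x})"]) auto
    qed
    then have "|S (Suc n)| \<le>o |A \<times> S n|"
      using card_of_image card_of_mono1 ordLeq_transitive by blast
    moreover have "|A \<times> S n| \<le>o |B|"
      using inf le Suc by (intro card_of_Sigma_ordLeq_infinite) auto
    ultimately show ?case by (rule ordLeq_transitive)
  qed
  moreover have "|UNIV :: nat set| \<le>o |B|"
    using inf infinite_iff_card_of_nat by blast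
  ultimately have "|\<Union>n. S n| \<le>o |B|"
    using inf by (intro card_of_UNION_ordLeq_infinite) auto
  moreover have "{F. finite F \<and> F \<subseteq> A} = (\<Union>n. S n)"
    by (auto simp: S_def)
  ultimately show ?thesis by simp
qed

end

section \<open>Finite conditions and their amalgamation\<close>

definition alternates :: "'a::linorder set \<Rightarrow> 'a set \<Rightarrow> bool" where
  "alternates V X \<longleftrightarrow> (\<exists>q1\<in>X. \<exists>q2\<in>X. \<exists>q3\<in>X. \<exists>q4\<in>X.
     q1 < q2 \<and> q2 < q3 \<and> q3 < q4 \<and> q1 \<in> V \<and> q2 \<notin> V \<and> q3 \<in> V \<and> q4 \<notin> V)"

lemma alternates_mono: "alternates V X \<Longrightarrow> X \<subseteq> Y \<Longrightarrow> alternates V Y"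
  unfolding alternates_def by blast

text \<open>\<open>p\<close> need not be a function: a point counts at \<open>n\<close> as soon as
  one of its ranks is at most \<open>n\<close>. Hence the level of a union is the union of the
  levels.\<close>

definition level :: "('a \<times> nat) set \<Rightarrow> nat \<Rightarrow> 'a set" where
  "level p n = {q. \<exists>j\<le>n. (q, j) \<in> p}"

lemma level_subset: "level p n \<subseteq> fst ` p"
  unfolding level_def by force

definition alternation_free :: "('a::linorder \<Rightarrow> nat set) \<Rightarrow> ('a \<times> nat) set \<Rightarrow> bool" where
  "alternation_free A p \<longleftrightarrow> (\<forall>n. \<not> alternates {q. n \<in> A q} (level p n))"

definition conditions :: "('a::linorder \<Rightarrow> nat set) \<Rightarrow> 'a set \<Rightarrow> ('a \<times> nat) set set" where
  "conditions A Q = {p. finite p \<and> p \<subseteq> Q \<times> UNIV \<and> alternation_free A p}"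

text \<open>For finite \<open>R\<close> this initial segment encodes the half-open interval between
  consecutive points of \<open>R\<close> that contains \<open>q\<close>. Finite subsets of a
  countable set serve as codes because there are only countably many of them.\<close>

definition cell :: "'a::linorder set \<Rightarrow> 'a \<Rightarrow> 'a set" where
  "cell R q = {r \<in> R. r \<le> q}"

lemma cell_mono: "q \<le> q' \<Longrightarrow> cell R q \<subseteq> cell R q'"
  unfolding cell_def by auto

text \<open>What a countable classification can retain of a condition: its points come from a
  possibly uncountable set, so only their positions relative to \<open>R\<close> are kept.\<close>

definition pattern :: "('a::linorder \<Rightarrow> nat set) \<Rightarrow> 'a set \<Rightarrow> nat \<Rightarrow> ('a \<times> nat) set \<Rightarrow> ('a set \<times> nat \<times> nat set) set" where
  "pattern A R m p = (\<lambda>(q, j). (cell R q, j, A q \<inter> {..<m})) ` p"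

text \<open>Inclusions are demanded only against points of \<open>R\<close>: points of two different
  conditions need not be directly comparable above \<open>m\<close>, but both conditions can share
  the same \<open>R\<close>.\<close>

definition adapted :: "('a::linorder \<Rightarrow> nat set) \<Rightarrow> 'a set \<Rightarrow> nat \<Rightarrow> ('a \<times> nat) set \<Rightarrow> bool" where
  "adapted A R m p \<longleftrightarrow> inj_on (cell R) (fst ` p) \<and>
     (\<forall>n\<ge>m. \<forall>q\<in>fst ` p. \<forall>r\<in>R. (q < r \<and> n \<in> A q \<longrightarrow> n \<in> A r) \<and> (r \<le> q \<and> n \<in> A r \<longrightarrow> n \<in> A q))"

text \<open>Points in different cells have some \<open>r\<close> in \<open>R\<close> between them;
  membership of \<open>n\<close> passes from \<open>q\<close> to \<open>r\<close> and on to
  \<open>q'\<close>, even when \<open>q\<close> and \<open>q'\<close> come from different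
  conditions.\<close>

lemma adapted_same_cell:
  assumes "adapted A R m p" "adapted A R m p'" "m \<le> n"
    and "q \<in> fst ` (p \<union> p')" "q' \<in> fst ` (p \<union> p')" "q < q'" "n \<in> A q" "n \<notin> A q'"
  shows "cell R q = cell R q'"
proof (rule ccontr)
  assume "cell R q \<noteq> cell R q'"
  then obtain r where r: "r \<in> R" "q < r" "r \<le> q'"
    using \<open>q < q'\<close> unfolding cell_def by force
  have "n \<in> A r" using assms r unfolding adapted_def image_Un by blast
  then have "n \<in> A q'" using assms r unfolding adapted_def image_Un by blast
  then show False using assms by simp
qed

text \<open>Below \<open>m\<close> the common pattern moves an alternation of the union into
  \<open>p\<close> alone. From \<open>m\<close> on, a drop from in to out stays within one cell, so
  all four points share a cell, where each condition has at most one point.\<close>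

lemma alternation_free_Un:
  assumes p: "alternation_free A p" "adapted A R m p"
    and p': "alternation_free A p'" "adapted A R m p'"
    and eq: "pattern A R m p = pattern A R m p'"
  shows "alternation_free A (p \<union> p')"
  unfolding alternation_free_def
proof (intro allI notI)
  fix n assume "alternates {q. n \<in> A q} (level (p \<union> p') n)"
  then obtain q1 q2 q3 q4 where q: "q1 \<in> level (p \<union> p') n" "q2 \<in> level (p \<union> p') n"
      "q3 \<in> level (p \<union> p') n" "q4 \<in> level (p \<union> p') n"
    and lt: "q1 < q2" "q2 < q3" "q3 < q4"
    and val: "n \<in> A q1" "n \<notin> A q2" "n \<in> A q3" "n \<notin> A q4"
    unfolding alternates_def by auto
  show False
  proof (cases "n < m")
    case True
    \<comment> \<open>Equal patterns give every point of the union a counterpart in \<open>p\<close>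
      with the same cell and rank and the same membership of \<open>n < m\<close>.\<close>
    have "\<exists>q'\<in>level p n. cell R q' = cell R q \<and> (n \<in> A q' \<longleftrightarrow> n \<in> A q)" 
      if "q \<in> level (p \<union> p') n" for q
    proof -
      from that obtain j where j: "j \<le> n" "(q, j) \<in> p \<union> p'" unfolding level_def by auto
      then have "(cell R q, j, A q \<inter> {..<m}) \<in> pattern A R m (p \<union> p')"
        unfolding pattern_def by force
      also have "pattern A R m (p \<union> p') = pattern A R m p"
        using eq unfolding pattern_def by (simp add: image_Un)
      finally obtain q' where "(q', j) \<in> p" "cell R q' = cell R q" "A q' \<inter> {..<m} = A q \<inter> {..<m}"
        unfolding pattern_def by auto
      then show ?thesis using j True unfolding level_def by blast
    qed
    then obtain h where h: "\<And>q. q \<in> level (p \<union> p') n \<Longrightarrow>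
        h q \<in> level p n \<and> cell R (h q) = cell R q \<and> (n \<in> A (h q) \<longleftrightarrow> n \<in> A q)"
      by metis
    \<comment> \<open>Cells are monotone, so a reversal would force equal cells, hence
      \<open>h q = h q'\<close> by injectivity, against the differing membership.\<close>
    have less: "h q < h q'" if qq: "q \<in> level (p \<union> p') n" "q' \<in> level (p \<union> p') n" "q < q'"
      "(n \<in> A q) \<noteq> (n \<in> A q')" for q q'
    proof (rule ccontr)
      assume "\<not> h q < h q'"
      then have "cell R (h q') \<subseteq> cell R (h q)" by (intro cell_mono) simp
      moreover have "cell R q \<subseteq> cell R q'" using qq by (intro cell_mono) simp
      ultimately have "cell R (h q') = cell R (h q)" using h qq by blast
      moreover have "h q \<in> fst ` p" "h q' \<in> fst ` p"
        using h[OF qq(1)] h[OF qq(2)] level_subset[of p n] by auto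
      ultimately have "h q = h q'" using p(2) unfolding adapted_def by (metis inj_on_def)
      then show False using h qq by metis
    qed
    have "alternates {q. n \<in> A q} (level p n)"
      unfolding alternates_def
      using less[OF q(1,2) lt(1)] less[OF q(2,3) lt(2)] less[OF q(3,4) lt(3)] h q val
      by (intro bexI[of _ "h q1"] bexI[of _ "h q2"] bexI[of _ "h q3"] bexI[of _ "h q4"]) auto
    then show False using p(1) unfolding alternation_free_def by blast
  next
    case False
    then have mn: "m \<le> n" by simp
    have dom: "q1 \<in> fst ` (p \<union> p')" "q2 \<in> fst ` (p \<union> p')" "q3 \<in> fst ` (p \<union> p')" "q4 \<in> fst ` (p \<union> p')"
      using q by (simp_all only: subsetD[OF level_subset])
    note same = adapted_same_cell[OF p(2) p'(2) mn]
    \<comment> \<open>The three drops used link all four points into one cell. Then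
      \<open>q1\<close>, \<open>q2\<close>, \<open>q3\<close> are spread over two conditions, so two
      of them lie in the same one and must coincide.\<close>
    have c: "cell R q1 = cell R q2" "cell R q1 = cell R q4" "cell R q3 = cell R q4"
      using same[OF dom(1,2)] same[OF dom(1,4)] same[OF dom(3,4)] lt val by auto
    have inj: "x = y" if "cell R x = cell R y" "x \<in> fst ` p \<and> y \<in> fst ` p \<or> x \<in> fst ` p' \<and> y \<in> fst ` p'" for x y
      using that p(2) p'(2) unfolding adapted_def by (metis inj_on_def)
    have mem: "q \<in> fst ` p \<or> q \<in> fst ` p'" if "q \<in> fst ` (p \<union> p')" for q
      using that unfolding image_Un by blast
    have "cell R q2 = cell R q3" "cell R q1 = cell R q3" using c by simp_all
    then show False
      using mem[OF dom(1)] mem[OF dom(2)] mem[OF dom(3)] inj[of q1 q2] inj[of q2 q3] inj[of q1 q3] c(1) lt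
      by (metis less_irrefl less_trans)
  qed
qed

section \<open>Countable chain condition and density\<close>

lemma pattern_countable:
  assumes "countable D"
  shows "countable ({R. finite R \<and> R \<subseteq> D} \<times> (UNIV :: nat set) \<times>
     {T. finite T \<and> T \<subseteq> {R. finite R \<and> R \<subseteq> D} \<times> (UNIV :: nat set) \<times> {B :: nat set. finite B}})"
proof -
  have "countable {B :: nat set. finite B}"
    using countable_Collect_finite_subset[of "UNIV :: nat set"] by simp
  then show ?thesis
    by (intro countable_SIGMA countable_Collect_finite_subset assms) auto
qed

text \<open>The finitely many finite differences between sets indexed by \<open>Y\<close> have a
  common upper bound.\<close>

lemma ex_eventual_chain:
  assumes Y: "finite Y"
    and chain: "\<And>q q'. q \<in> Y \<Longrightarrow> q' \<in> Y \<Longrightarrow> q < q' \<Longrightarrow> finite (A q - A q')"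
  shows "\<exists>m::nat. \<forall>n\<ge>m. \<forall>q\<in>Y. \<forall>q'\<in>Y. (q::'a::linorder) \<le> q' \<longrightarrow> n \<in> A q \<longrightarrow> n \<in> A q'"
proof -
  define E where "E = (\<Union>(q, q')\<in>{(q, q') \<in> Y \<times> Y. q < q'}. A q - A q')"
  have "finite {(q, q') \<in> Y \<times> Y. q < q'}"
    by (rule finite_subset[of _ "Y \<times> Y"]) (use Y in auto)
  then have "finite E" unfolding E_def using chain by (intro finite_UN_I) auto
  then obtain m where m: "\<And>n. n \<in> E \<Longrightarrow> n < m" 
    using finite_nat_set_iff_bounded by auto
  have "n \<in> A q'" if "q \<in> Y" "q' \<in> Y" "q \<le> q'" "n \<in> A q" "m \<le> n" for n q q'
  proof (rule ccontr)
    assume "n \<notin> A q'"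
    then have "n \<in> E" using that unfolding E_def
      by (intro UN_I[of "(q, q')"]) (auto simp: less_le)
    then show False using m that by fastforce
  qed
  then show ?thesis by blast
qed

text \<open>\<open>R\<close> takes one separating point of \<open>D\<close> for every pair of points
  of \<open>p\<close>; then \<open>m\<close> is chosen for the points of \<open>p\<close> and of
  \<open>R\<close> together.\<close>

lemma ex_adapted:
  assumes chain: "\<And>q q'. q \<in> Q \<Longrightarrow> q' \<in> Q \<Longrightarrow> q < q' \<Longrightarrow> finite (A q - A q')"
    and D: "D \<subseteq> Q" "\<And>q q'. q \<in> Q \<Longrightarrow> q' \<in> Q \<Longrightarrow> q < q' \<Longrightarrow> \<exists>r\<in>D. q < r \<and> r \<le> q'"
    and p: "finite p" "p \<subseteq> Q \<times> UNIV"
  shows "\<exists>R m. finite R \<and> R \<subseteq> D \<and> adapted A R m p"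
proof -
  let ?X = "fst ` p"
  have X: "finite ?X" "?X \<subseteq> Q" using p by auto
  obtain s where s: "\<And>q q'. q \<in> Q \<Longrightarrow> q' \<in> Q \<Longrightarrow> q < q' \<Longrightarrow> s q q' \<in> D \<and> q < s q q' \<and> s q q' \<le> q'"
    using D(2) by metis
  define R where "R = (\<lambda>(q, q'). s q q') ` {(q, q') \<in> ?X \<times> ?X. q < q'}"
  have "finite {(q, q') \<in> ?X \<times> ?X. q < q'}"
    by (rule finite_subset[of _ "?X \<times> ?X"]) (use X in auto)
  then have R: "finite R" "R \<subseteq> D"
    using s X unfolding R_def by (auto intro!: finite_imageI)
  have "cell R q \<noteq> cell R q'" if "q \<in> ?X" "q' \<in> ?X" "q < q'" for q q'
  proof -
    have "s q q' \<in> R" using that unfolding R_def by (intro image_eqI[of _ _ "(q, q')"]) auto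
    moreover have "q < s q q'" "s q q' \<le> q'" using s[of q q'] that X by blast+
    ultimately have "s q q' \<in> cell R q'" "s q q' \<notin> cell R q" by (auto simp: cell_def)
    then show ?thesis by blast
  qed
  then have inj: "inj_on (cell R) ?X"
    unfolding inj_on_def by (metis linorder_neqE)
  define Y where "Y = ?X \<union> R"
  have Y: "finite Y" "Y \<subseteq> Q" using X R D unfolding Y_def by auto
  obtain m where step: "\<And>n q q'. m \<le> n \<Longrightarrow> q \<in> Y \<Longrightarrow> q' \<in> Y \<Longrightarrow> q \<le> q' \<Longrightarrow> n \<in> A q \<Longrightarrow> n \<in> A q'"
    using ex_eventual_chain[of Y A] Y chain by (metis subset_iff)
  have "adapted A R m p"
    unfolding adapted_def using inj step unfolding Y_def by (blast intro: less_imp_le)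
  then show ?thesis using R by blast
qed

text \<open>Send a condition to its \<open>R\<close>, its \<open>m\<close> and its pattern. Two
  conditions with the same image have a condition as their union, so the map is injective on
  \<open>C\<close>, and its values lie in a countable set.\<close>

lemma countable_pairwise_incompatible:
  assumes chain: "\<And>q q'. q \<in> Q \<Longrightarrow> q' \<in> Q \<Longrightarrow> q < q' \<Longrightarrow> finite (A q - A q')"
    and D: "D \<subseteq> Q" "\<And>q q'. q \<in> Q \<Longrightarrow> q' \<in> Q \<Longrightarrow> q < q' \<Longrightarrow> \<exists>r\<in>D. q < r \<and> r \<le> q'" "countable D"
    and C: "C \<subseteq> conditions A Q"
    and incomp: "\<And>p p'. p \<in> C \<Longrightarrow> p' \<in> C \<Longrightarrow> p \<noteq> p' \<Longrightarrow> p \<union> p' \<notin> conditions A Q"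
  shows "countable C"
proof -
  have "\<exists>R m. finite R \<and> R \<subseteq> D \<and> adapted A R m p" if "p \<in> C" for p
  proof (rule ex_adapted)
    show "finite p" "p \<subseteq> Q \<times> UNIV" using that C unfolding conditions_def by auto
  qed (use chain D in auto)
  then obtain R m where Rm: "\<And>p. p \<in> C \<Longrightarrow> finite (R p) \<and> R p \<subseteq> D \<and> adapted A (R p) (m p) p"
    by metis
  define t where "t p = (R p, m p, pattern A (R p) (m p) p)" for p
  have "inj_on t C"
  proof (rule inj_onI, rule ccontr)
    fix p p' assume *: "p \<in> C" "p' \<in> C" "t p = t p'" "p \<noteq> p'"
    then have "alternation_free A (p \<union> p')"
      using Rm[of p] Rm[of p'] C
      by (intro alternation_free_Un[of A p "R p" "m p" p']) (auto simp: t_def conditions_def)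
    then have "p \<union> p' \<in> conditions A Q"
      using * C unfolding conditions_def by blast
    then show False using incomp * by blast
  qed
  moreover have "t ` C \<subseteq> {R. finite R \<and> R \<subseteq> D} \<times> UNIV \<times>
     {T. finite T \<and> T \<subseteq> {R. finite R \<and> R \<subseteq> D} \<times> UNIV \<times> {B :: nat set. finite B}}"
  proof (rule image_subsetI)
    fix p assume p: "p \<in> C"
    have "finite (cell (R p) q)" "cell (R p) q \<subseteq> D" for q
      using Rm[OF p] unfolding cell_def by auto
    then have "pattern A (R p) (m p) p \<subseteq> {R. finite R \<and> R \<subseteq> D} \<times> UNIV \<times> {B :: nat set. finite B}"
      unfolding pattern_def by auto
    moreover have "finite (pattern A (R p) (m p) p)"
      using p C unfolding pattern_def conditions_def by auto
    ultimately show "t p \<in> {R. finite R \<and> R \<subseteq> D} \<times> UNIV \<times>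
        {T. finite T \<and> T \<subseteq> {R. finite R \<and> R \<subseteq> D} \<times> UNIV \<times> {B :: nat set. finite B}}"
      using Rm[OF p] unfolding t_def by blast
  qed
  then have "countable (t ` C)"
    using pattern_countable[OF D(3)] countable_subset by blast
  ultimately show ?thesis
    using countable_image_inj_on by blast
qed

text \<open>The new point gets a rank \<open>m\<close> from which on the finitely many sets involved
  form a genuine chain; below \<open>m\<close> the new pair is invisible.\<close>

lemma ex_extension:
  assumes chain: "\<And>q q'. q \<in> Q \<Longrightarrow> q' \<in> Q \<Longrightarrow> q < q' \<Longrightarrow> finite (A q - A q')"
    and p: "p \<in> conditions A Q" and q: "q \<in> Q"
  shows "\<exists>j. insert (q, j) p \<in> conditions A Q"
proof -
  define Y where "Y = insert q (fst ` p)"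
  have Y: "finite Y" "Y \<subseteq> Q" using p q unfolding Y_def conditions_def by auto
  obtain m where step: "\<And>n q q'. m \<le> n \<Longrightarrow> q \<in> Y \<Longrightarrow> q' \<in> Y \<Longrightarrow> q \<le> q' \<Longrightarrow> n \<in> A q \<Longrightarrow> n \<in> A q'"
    using ex_eventual_chain[of Y A] Y chain by (metis subset_iff)
  have "alternation_free A (insert (q, m) p)"
    unfolding alternation_free_def
  proof (intro allI notI)
    fix n assume alt: "alternates {q. n \<in> A q} (level (insert (q, m) p) n)"
    show False
    proof (cases "n < m")
      case True
      then have "level (insert (q, m) p) n = level p n" unfolding level_def by auto
      then show False using alt p unfolding conditions_def alternation_free_def by auto
    next
      case False
      have "level (insert (q, m) p) n \<subseteq> Y" using level_subset[of "insert (q, m) p" n] unfolding Y_def by simp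
      then obtain q1 q2 where "q1 \<in> Y" "q2 \<in> Y" "q1 < q2" "n \<in> A q1" "n \<notin> A q2"
        using alt unfolding alternates_def by blast
      then show False using step[of n q1 q2] False by (simp add: less_imp_le)
    qed
  qed
  then show ?thesis using p q unfolding conditions_def by blast
qed

section \<open>Application of Martin's Axiom\<close>

context
  includes cardinal_syntax
begin

text \<open>A filter meeting the right dense sets ranks every point of \<open>Q\<close>. An
  alternation involves only four points, and these already occur together in one condition of the
  filter.\<close>

lemma ex_alternation_free_rank:
  fixes \<kappa> :: "'k rel" and A :: "'a::linorder \<Rightarrow> nat set"
  assumes \<kappa>: "Card_order \<kappa>" "martins_axiom \<kappa>"
    and Q: "infinite Q \<Longrightarrow> |Q| \<le>o \<kappa>"
    and chain: "\<And>q q'. q \<in> Q \<Longrightarrow> q' \<in> Q \<Longrightarrow> q < q' \<Longrightarrow> finite (A q - A q')"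
    and D: "D \<subseteq> Q" "\<And>q q'. q \<in> Q \<Longrightarrow> q' \<in> Q \<Longrightarrow> q < q' \<Longrightarrow> \<exists>r\<in>D. q < r \<and> r \<le> q'" "countable D"
  shows "\<exists>g. \<forall>n. \<not> alternates {q. n \<in> A q} {q \<in> Q. g q \<le> n}"
proof (cases "finite Q")
  case True
  \<comment> \<open>The bound by \<open>\<kappa>\<close> is available for infinite \<open>Q\<close>;
    for finite \<open>Q\<close> a constant rank works, chosen so that the sets form a genuine chain
    from there on.\<close>
  obtain m where step: "\<And>n q q'. m \<le> n \<Longrightarrow> q \<in> Q \<Longrightarrow> q' \<in> Q \<Longrightarrow> q \<le> q' \<Longrightarrow> n \<in> A q \<Longrightarrow> n \<in> A q'"
    using ex_eventual_chain[of Q A] True chain by metis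
  have "\<not> alternates {q. n \<in> A q} {q \<in> Q. m \<le> n}" for n
    using step unfolding alternates_def by (blast intro: less_imp_le)
  then show ?thesis by (intro exI[of _ "\<lambda>_. m"]) blast
next
  case False
  \<comment> \<open>\<open>martins_axiom\<close> speaks of posets inside the type \<open>'k\<close>,
    so the conditions are coded there by an injection \<open>\<phi>\<close>.\<close>
  have leU: "|Q| \<le>o |UNIV :: 'k set|"
    using Q[OF False] card_of_Field_ordIso[OF \<kappa>(1)] card_of_mono1[of "Field \<kappa>" UNIV]
    by (meson ordLeq_ordIso_trans ordIso_symmetric ordLeq_transitive subset_UNIV)
  then have infU: "infinite (UNIV :: 'k set)"
    using False card_of_ordLeq_finite by blast
  have "|Q \<times> (UNIV :: nat set)| \<le>o |UNIV :: 'k set|"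
    using infU leU infinite_iff_card_of_nat by (intro card_of_Sigma_ordLeq_infinite) auto
  then have "|{p. finite p \<and> p \<subseteq> Q \<times> (UNIV :: nat set)}| \<le>o |UNIV :: 'k set|"
    by (rule card_of_finite_subsets_ordLeq_infinite[OF infU])
  then obtain \<phi> :: "('a \<times> nat) set \<Rightarrow> 'k" where "inj_on \<phi> {p. finite p \<and> p \<subseteq> Q \<times> UNIV}"
    unfolding card_of_ordLeq[symmetric] by blast
  moreover let ?C = "conditions A Q"
  have "?C \<subseteq> {p. finite p \<and> p \<subseteq> Q \<times> UNIV}" by (auto simp: conditions_def)
  ultimately have inj: "inj_on \<phi> ?C" by (rule inj_on_subset)
  define P where "P = \<phi> ` ?C"
  \<comment> \<open>Larger conditions are stronger.\<close>
  define r where "r = {(\<phi> p, \<phi> p') | p p'. p \<in> ?C \<and> p' \<in> ?C \<and> p' \<subseteq> p}"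
  have r_iff: "(\<phi> p, \<phi> p') \<in> r \<longleftrightarrow> p' \<subseteq> p" if "p \<in> ?C" "p' \<in> ?C" for p p'
    using that inj_on_eq_iff[OF inj] unfolding r_def by auto
  have po: "partial_order_on P r"
    unfolding partial_order_on_def preorder_on_def
  proof (intro conjI)
    show "r \<subseteq> P \<times> P" by (auto simp: r_def P_def)
    show "refl_on P r" by (auto simp: refl_on_def P_def r_iff)
    show "trans r"
    proof (rule transI)
      fix x y z assume "(x, y) \<in> r" "(y, z) \<in> r"
      then obtain p p' p'' where "x = \<phi> p" "y = \<phi> p'" "z = \<phi> p''" "p \<in> ?C" "p' \<in> ?C" "p'' \<in> ?C"
        unfolding r_def by blast
      then show "(x, z) \<in> r" using \<open>(x, y) \<in> r\<close> \<open>(y, z) \<in> r\<close> by (auto simp: r_iff)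
    qed
    show "antisym r"
    proof (rule antisymI)
      fix x y assume "(x, y) \<in> r" "(y, x) \<in> r"
      then obtain p p' where "x = \<phi> p" "y = \<phi> p'" "p \<in> ?C" "p' \<in> ?C"
        unfolding r_def by blast
      then show "x = y" using \<open>(x, y) \<in> r\<close> \<open>(y, x) \<in> r\<close> by (auto simp: r_iff)
    qed
  qed
  have ccc: "ccc P r"
    unfolding ccc_def
  proof (intro allI impI)
    fix S assume S: "S \<subseteq> P" "pairwise (\<lambda>p q. \<not> compatible P r p q) S"
    define C where "C = {p \<in> ?C. \<phi> p \<in> S}"
    have "p \<union> p' \<notin> ?C" if "p \<in> C" "p' \<in> C" "p \<noteq> p'" for p p'
    proof
      assume "p \<union> p' \<in> ?C"
      then have "compatible P r (\<phi> p) (\<phi> p')"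
        using that unfolding compatible_def P_def C_def
        by (intro bexI[of _ "\<phi> (p \<union> p')"]) (auto simp: r_iff)
      moreover have "\<phi> p \<noteq> \<phi> p'"
        using that inj_on_eq_iff[OF inj] unfolding C_def by auto
      ultimately show False using S(2) that unfolding C_def pairwise_def by blast
    qed
    then have "countable C"
      by (intro countable_pairwise_incompatible[of Q A D C] chain D) (auto simp: C_def)
    moreover have "S = \<phi> ` C" using S(1) unfolding C_def P_def by auto
    ultimately show "countable S" by simp
  qed
  \<comment> \<open>Meeting \<open>dn q\<close> is what gives \<open>q\<close> a rank.\<close>
  define dn where "dn q = \<phi> ` {p \<in> ?C. \<exists>j. (q, j) \<in> p}" for q
  have dense: "\<forall>d\<in>dn ` Q. dense_in_poset P r d"
  proof
    fix d assume "d \<in> dn ` Q"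
    then obtain q where q: "q \<in> Q" "d = dn q" by blast
    have "\<exists>d\<in>dn q. (d, \<phi> p) \<in> r" if p: "p \<in> ?C" for p
    proof -
      obtain j where j: "insert (q, j) p \<in> ?C"
        using ex_extension[OF chain p q(1)] by blast
      then have "\<phi> (insert (q, j) p) \<in> dn q" "(\<phi> (insert (q, j) p), \<phi> p) \<in> r"
        using p by (auto simp: dn_def r_iff)
      then show ?thesis by blast
    qed
    then show "dense_in_poset P r d"
      unfolding dense_in_poset_def q P_def by (auto simp: dn_def)
  qed
  have "{} \<in> ?C" by (auto simp: conditions_def alternation_free_def alternates_def level_def)
  then have "P \<noteq> {}" unfolding P_def by blast
  moreover have "|dn ` Q| \<le>o \<kappa>" using card_of_image Q[OF False] ordLeq_transitive by blast
  ultimately have "P \<noteq> {} \<and> partial_order_on P r \<and> ccc P r \<and>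
      (\<forall>D\<in>dn ` Q. dense_in_poset P r D) \<and> |dn ` Q| \<le>o \<kappa>"
    using po ccc dense by simp
  note \<kappa>(2)[unfolded martins_axiom_def, THEN spec[of _ P], THEN spec[of _ r],
      THEN spec[of _ "dn ` Q"], THEN mp, OF this]
  then obtain G where G0: "filter_in_poset P r G \<and> (\<forall>d\<in>dn ` Q. G \<inter> d \<noteq> {})" ..
  then have G: "filter_in_poset P r G" "\<And>q. q \<in> Q \<Longrightarrow> G \<inter> dn q \<noteq> {}" by simp_all
  have "\<exists>j. \<exists>p\<in>?C. \<phi> p \<in> G \<and> (q, j) \<in> p" if "q \<in> Q" for q
  proof -
    have "G \<inter> dn q \<noteq> {}" using G(2) that .
    then obtain x where "x \<in> G" "x \<in> dn q" by auto
    moreover from this obtain p j where "p \<in> ?C" "x = \<phi> p" "(q, j) \<in> p" unfolding dn_def by auto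
    ultimately show ?thesis by auto
  qed
  \<comment> \<open>The filter may give a point several ranks; \<open>g\<close> picks one, together
    with a condition \<open>h q\<close> in the filter that witnesses it.\<close>
  then obtain g h where gh: "\<And>q. q \<in> Q \<Longrightarrow> h q \<in> ?C \<and> \<phi> (h q) \<in> G \<and> (q, g q) \<in> h q"
    by metis
  have directed: "\<exists>s\<in>?C. \<phi> s \<in> G \<and> p \<subseteq> s \<and> p' \<subseteq> s"
    if pp: "p \<in> ?C" "p' \<in> ?C" "\<phi> p \<in> G" "\<phi> p' \<in> G" for p p'
  proof -
    have "\<forall>x\<in>G. \<forall>y\<in>G. \<exists>s\<in>G. (s, x) \<in> r \<and> (s, y) \<in> r"
      using G(1) unfolding filter_in_poset_def by (elim conjE)
    then obtain s where s: "s \<in> G" "(s, \<phi> p) \<in> r" "(s, \<phi> p') \<in> r"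
      using pp(3,4) by metis
    then obtain s' where s': "s' \<in> ?C" "s = \<phi> s'" unfolding r_def by auto
    then have "p \<subseteq> s'" "p' \<subseteq> s'"
      using s r_iff[OF s'(1) pp(1)] r_iff[OF s'(1) pp(2)] by simp_all
    then show ?thesis using s s' by auto
  qed
  have "\<not> alternates {q. n \<in> A q} {q \<in> Q. g q \<le> n}" for n
  proof
    assume "alternates {q. n \<in> A q} {q \<in> Q. g q \<le> n}"
    then obtain q1 q2 q3 q4 where q: "q1 \<in> Q" "q2 \<in> Q" "q3 \<in> Q" "q4 \<in> Q"
      and n: "g q1 \<le> n" "g q2 \<le> n" "g q3 \<le> n" "g q4 \<le> n"
      and alt: "alternates {q. n \<in> A q} {q1, q2, q3, q4}"
      unfolding alternates_def by blast
    \<comment> \<open>Directedness, used three times, produces one condition containing all four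
      ranked points.\<close>
    obtain s where s: "s \<in> ?C" "\<phi> s \<in> G" "h q1 \<subseteq> s" "h q2 \<subseteq> s"
      using directed[of "h q1" "h q2"] gh[OF q(1)] gh[OF q(2)] by auto
    obtain s' where s': "s' \<in> ?C" "\<phi> s' \<in> G" "s \<subseteq> s'" "h q3 \<subseteq> s'"
      using directed[of s "h q3"] gh[OF q(3)] s(1,2) by auto
    obtain t where t: "t \<in> ?C" "s' \<subseteq> t" "h q4 \<subseteq> t"
      using directed[of s' "h q4"] gh[OF q(4)] s'(1,2) by auto
    have "(q1, g q1) \<in> t" "(q2, g q2) \<in> t" "(q3, g q3) \<in> t" "(q4, g q4) \<in> t"
      using gh[OF q(1)] gh[OF q(2)] gh[OF q(3)] gh[OF q(4)] s(3,4) s'(3,4) t(2,3) by (auto dest: subsetD)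
    then have "{q1, q2, q3, q4} \<subseteq> level t n" using n unfolding level_def by auto
    then have "alternates {q. n \<in> A q} (level t n)" using alt alternates_mono by blast
    then show False using t unfolding conditions_def alternation_free_def by blast
  qed
  then show ?thesis by blast
qed

end

section \<open>Cuts of a compact line\<close>

definition jump :: "'a::linorder \<Rightarrow> bool" where
  "jump q \<longleftrightarrow> (\<exists>s>q. {q<..<s} = {})"

text \<open>
  \<open>U\<close> is the set of those points of \<open>T\<close> whose cut lies to the right of \<open>z\<close>. The cut at a jump \<open>q\<close> lies
  between \<open>q\<close> and its successor, the one at any other \<open>q\<close> at \<open>q\<close> itself, so that such a \<open>q = z\<close> may be
  in \<open>U\<close> or not.
\<close>

definition cut_at :: "'a::linorder set \<Rightarrow> 'a set \<Rightarrow> 'a \<Rightarrow> bool" where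
  "cut_at T U z \<longleftrightarrow> (\<forall>q\<in>T. (q \<in> U \<longrightarrow> z \<le> q) \<and> (q \<notin> U \<longrightarrow> q \<le> z \<and> (jump q \<longrightarrow> q < z)))"

section \<open>Finitely many cuts nearly determine a continuous function\<close>

lemma empty_interval_iff: "{a<..<b} = {} \<longleftrightarrow> (\<forall>z::'a::linorder. z \<le> a \<or> b \<le> z)"
  unfolding set_eq_iff by (auto simp: not_less)

lemma cut_at_mono: "cut_at T U z \<Longrightarrow> T' \<subseteq> T \<Longrightarrow> cut_at T' U z"
  unfolding cut_at_def by blast

lemma cut_at_cong: "T \<inter> U = T \<inter> U' \<Longrightarrow> cut_at T U z \<longleftrightarrow> cut_at T U' z"
  unfolding cut_at_def by blast

text \<open>One cut controls the right side of \<open>x\<close>. If \<open>x\<close> is a jump, take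
  the cut at \<open>x\<close> and \<open>z\<close> below the successor. Otherwise take a cut at some
  \<open>q\<close> of \<open>Q\<close> slightly above \<open>x\<close>: \<open>z < q\<close> forces
  \<open>q\<close> into \<open>U\<close>, and hence \<open>z' \<le> q\<close>.\<close>

lemma cut_at_above:
  fixes x :: "'a::linorder_topology"
  assumes Q: "\<And>q. jump q \<Longrightarrow> q \<in> Q" "\<And>x y. {x<..<y} \<noteq> {} \<Longrightarrow> {x<..<y} \<inter> Q \<noteq> {}"
    and S: "open S" "x \<in> S"
  shows "\<exists>T N. finite T \<and> T \<subseteq> Q \<and> open N \<and> x \<in> N \<and>
    (\<forall>U. \<forall>z\<in>N. \<forall>z'. cut_at T U z \<longrightarrow> cut_at T U z' \<longrightarrow> z' \<le> x \<or> z' \<in> S)"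
proof -
  consider "\<forall>y. y \<le> x" | "jump x" | y where "x < y" "\<not> jump x"
    using not_le by blast
  then show ?thesis
  proof cases
    case 1
    then show ?thesis by (intro exI[of _ "{}"] exI[of _ UNIV]) auto
  next
    case 2
    then obtain s where s: "x < s" "{x<..<s} = {}" unfolding jump_def by blast
    have "z' \<le> x" if "z < s" "cut_at {x} U z" "cut_at {x} U z'" for U z z'
    proof -
      have "z \<le> x" using s(2) that(1) unfolding empty_interval_iff by (metis not_less)
      then show ?thesis using that 2 unfolding cut_at_def by auto
    qed
    then show ?thesis using s Q(1)[OF 2] by (intro exI[of _ "{x}"] exI[of _ "{..<s}"]) auto
  next
    case 3
    obtain b where b: "x < b" "{x..<b} \<subseteq> S" using open_right[OF S 3(1)] by blast
    then obtain q where q: "x < q" "q < b" "q \<in> Q"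
      using Q(2)[of x b] 3(2) unfolding jump_def by force
    have "z' \<le> x \<or> z' \<in> S" if "z < q" "cut_at {q} U z" "cut_at {q} U z'" for U z z'
    proof -
      have "z' \<le> q" using that unfolding cut_at_def by auto
      then have "z' < b" using q(2) by (rule le_less_trans)
      then show ?thesis using subsetD[OF b(2), of z'] by (cases "z' \<le> x") auto
    qed
    then show ?thesis using q by (intro exI[of _ "{q}"] exI[of _ "{..<q}"]) auto
  qed
qed

text \<open>The mirror image, except that the jump is now the immediate predecessor of
  \<open>x\<close>, if there is one; the strict clause of \<open>cut_at\<close> then pushes
  \<open>z'\<close> up to \<open>x\<close>.\<close>

lemma cut_at_below:
  fixes x :: "'a::linorder_topology"
  assumes Q: "\<And>q. jump q \<Longrightarrow> q \<in> Q" "\<And>x y. {x<..<y} \<noteq> {} \<Longrightarrow> {x<..<y} \<inter> Q \<noteq> {}"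
    and S: "open S" "x \<in> S"
  shows "\<exists>T N. finite T \<and> T \<subseteq> Q \<and> open N \<and> x \<in> N \<and>
    (\<forall>U. \<forall>z\<in>N. \<forall>z'. cut_at T U z \<longrightarrow> cut_at T U z' \<longrightarrow> x \<le> z' \<or> z' \<in> S)"
proof -
  consider "\<forall>y. x \<le> y" | p where "p < x" "{p<..<x} = {}" | y where "y < x" "\<forall>p<x. {p<..<x} \<noteq> {}"
    by (meson not_le)
  then show ?thesis
  proof cases
    case 1
    then show ?thesis by (intro exI[of _ "{}"] exI[of _ UNIV]) auto
  next
    case 2
    then have "jump p" unfolding jump_def by blast
    have "x \<le> z'" if "p < z" "cut_at {p} U z" "cut_at {p} U z'" for U z z'
    proof -
      have "p < z'" using that \<open>jump p\<close> unfolding cut_at_def by auto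
      then show ?thesis using 2 unfolding empty_interval_iff by (metis not_less)
    qed
    then show ?thesis using 2 Q(1)[OF \<open>jump p\<close>] by (intro exI[of _ "{p}"] exI[of _ "{p<..}"]) auto
  next
    case 3
    obtain b where b: "b < x" "{b<..x} \<subseteq> S" using open_left[OF S 3(1)] by blast
    then obtain q where q: "b < q" "q < x" "q \<in> Q"
      using Q(2)[of b x] 3(2) by force
    have "x \<le> z' \<or> z' \<in> S" if "q < z" "cut_at {q} U z" "cut_at {q} U z'" for U z z'
    proof -
      have "q \<le> z'" using that unfolding cut_at_def by auto
      with q(1) have "b < z'" by (rule less_le_trans)
      then show ?thesis using subsetD[OF b(2), of z'] by (cases "x \<le> z'") auto
    qed
    then show ?thesis using q by (intro exI[of _ "{q}"] exI[of _ "{q<..}"]) auto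
  qed
qed

text \<open>Locally the two one-sided lemmas apply, and compactness makes \<open>T\<close> finite.
  Only \<open>z\<close> has to lie in the neighbourhood; \<open>z'\<close> is arbitrary apart from
  its cut, so a cover catching \<open>z\<close> suffices.\<close>

lemma ex_finite_cuts:
  fixes f :: "'a::linorder_topology \<Rightarrow> real"
  assumes compact: "compact (UNIV :: 'a set)"
    and Q: "\<And>q. jump q \<Longrightarrow> q \<in> Q" "\<And>x y. {x<..<y} \<noteq> {} \<Longrightarrow> {x<..<y} \<inter> Q \<noteq> {}"
    and f: "continuous_on UNIV f" and e: "0 < e"
  shows "\<exists>T. finite T \<and> T \<subseteq> Q \<and> (\<forall>U z z'. cut_at T U z \<longrightarrow> cut_at T U z' \<longrightarrow> \<bar>f z - f z'\<bar> < e)"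
proof -
  have "\<exists>T N. finite T \<and> T \<subseteq> Q \<and> open N \<and> x \<in> N \<and>
    (\<forall>U. \<forall>z\<in>N. \<forall>z'. cut_at T U z \<longrightarrow> cut_at T U z' \<longrightarrow> \<bar>f z - f z'\<bar> < e)" for x
  proof -
    define S where "S = f -` ball (f x) (e / 2)"
    have S: "open S" "x \<in> S"
      using f e unfolding S_def by (auto simp: open_vimage)
    from cut_at_above[OF Q S] obtain T1 N1 where 1: "finite T1" "T1 \<subseteq> Q" "open N1" "x \<in> N1"
      "\<And>U z z'. z \<in> N1 \<Longrightarrow> cut_at T1 U z \<Longrightarrow> cut_at T1 U z' \<Longrightarrow> z' \<le> x \<or> z' \<in> S" by metis
    from cut_at_below[OF Q S] obtain T2 N2 where 2: "finite T2" "T2 \<subseteq> Q" "open N2" "x \<in> N2"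
      "\<And>U z z'. z \<in> N2 \<Longrightarrow> cut_at T2 U z \<Longrightarrow> cut_at T2 U z' \<Longrightarrow> x \<le> z' \<or> z' \<in> S" by metis
    have "\<bar>f z - f z'\<bar> < e"
      if z: "z \<in> N1 \<inter> N2 \<inter> S" "cut_at (T1 \<union> T2) U z" "cut_at (T1 \<union> T2) U z'" for U z z'
    proof -
      \<comment> \<open>If \<open>z'\<close> were outside \<open>S\<close>, both alternatives would
        give \<open>z' = x\<close>, which is in \<open>S\<close>.\<close>
      have "z' \<le> x \<or> z' \<in> S" "x \<le> z' \<or> z' \<in> S"
        using 1(5)[of z U z'] 2(5)[of z U z'] z cut_at_mono[of "T1 \<union> T2" U] by auto
      then have "z' \<in> S" using S(2) by (metis order_antisym)
      moreover have "z \<in> S" using z by blast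
      ultimately have "dist (f x) (f z) < e / 2" "dist (f x) (f z') < e / 2" unfolding S_def by auto
      then show ?thesis by (metis dist_triangle_half_r dist_real_def)
    qed
    then show ?thesis using 1 2 S
      by (intro exI[of _ "T1 \<union> T2"] exI[of _ "N1 \<inter> N2 \<inter> S"]) auto
  qed
  then obtain T N where TN: "\<And>x. finite (T x) \<and> T x \<subseteq> Q \<and> open (N x) \<and> x \<in> N x"
    "\<And>x U z z'. z \<in> N x \<Longrightarrow> cut_at (T x) U z \<Longrightarrow> cut_at (T x) U z' \<Longrightarrow> \<bar>f z - f z'\<bar> < e"
    by metis
  obtain I where I: "finite I" "UNIV \<subseteq> (\<Union>x\<in>I. N x)"
  proof (rule compactE_image[OF compact, of UNIV N])
    show "open (N x)" for x using TN(1) by simp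
    show "UNIV \<subseteq> (\<Union>x\<in>UNIV. N x)" using TN(1) by auto
  qed auto
  have "\<bar>f z - f z'\<bar> < e" if z: "cut_at (\<Union>x\<in>I. T x) U z" "cut_at (\<Union>x\<in>I. T x) U z'" for U z z'
  proof -
    obtain x where "x \<in> I" "z \<in> N x" using I by blast
    then show ?thesis using TN(2)[of z x U z'] z cut_at_mono[of "\<Union>x\<in>I. T x" U _ "T x"] by blast
  qed
  then show ?thesis using I(1) TN(1) by (intro exI[of _ "\<Union>x\<in>I. T x"]) blast
qed

section \<open>From bounded alternation to three points\<close>

lemma ex_cut_at:
  fixes X :: "'a::linorder_topology set"
  assumes compact: "compact (UNIV :: 'a set)"
    and up: "\<And>w q. w \<in> W \<Longrightarrow> q \<in> X \<Longrightarrow> w \<le> q \<Longrightarrow> q \<in> W"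
  shows "\<exists>a. cut_at X W a"
proof -
  \<comment> \<open>The cut is realised by the greatest lower bound of \<open>W\<close>: the maximum
    of its compact set of lower bounds, which contains the least point of the line.\<close>
  define B where "B = (\<Inter>w\<in>W. {..w})"
  obtain m where m: "\<And>x :: 'a. m \<le> x" using compact_attains_inf[OF compact] by auto
  have "closed B" unfolding B_def by (intro closed_INT) auto
  then have "compact B" using compact_Int_closed[OF compact, of B] by simp
  moreover have "m \<in> B" using m unfolding B_def by auto
  ultimately obtain a where a: "a \<in> B" "\<And>b. b \<in> B \<Longrightarrow> b \<le> a"
    using compact_attains_sup[of B] by blast
  have "a \<le> q" if "q \<in> W" for q using a(1) that unfolding B_def by auto
  moreover have "q \<le> a \<and> (jump q \<longrightarrow> q < a)" if "q \<in> X" "q \<notin> W" for q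
  proof -
    have qw: "q < w" if "w \<in> W" for w using up[OF that \<open>q \<in> X\<close>] \<open>q \<notin> W\<close> by force
    then have "q \<in> B" unfolding B_def by (auto intro: less_imp_le)
    \<comment> \<open>The successor of a jump below \<open>W\<close> is still a lower bound of
      \<open>W\<close>.\<close>
    moreover have "q < a" if "jump q"
    proof -
      obtain s where s: "q < s" "{q<..<s} = {}" using \<open>jump q\<close> unfolding jump_def by blast
      then have "s \<in> B" using qw unfolding B_def empty_interval_iff by (metis INT_I atMost_iff not_less)
      then show ?thesis using a(2) s(1) by force
    qed
    ultimately show ?thesis using a(2) by blast
  qed
  ultimately show ?thesis unfolding cut_at_def by blast
qed

text \<open>The final segments start where the pattern in, then in-out, then in-out-in has been
  completed. On \<open>X\<close> the indicator of \<open>V\<close> is that of \<open>Wa\<close>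
  minus that of \<open>Wb\<close> plus that of \<open>Wc\<close>, since a fourth switch is
  excluded.\<close>

lemma not_alternates_decomp:
  assumes "\<not> alternates V X"
  shows "\<exists>Wa Wb Wc. Wc \<subseteq> Wb \<and> Wb \<subseteq> Wa \<and>
    (\<forall>W\<in>{Wa, Wb, Wc}. \<forall>w\<in>W. \<forall>q\<in>X. w \<le> q \<longrightarrow> q \<in> W) \<and>
    (\<forall>q\<in>X. q \<in> V \<longleftrightarrow> q \<in> Wa \<and> q \<notin> Wb \<or> q \<in> Wc)"
proof -
  define Wa where "Wa = {q \<in> X. \<exists>q1\<in>X. q1 \<le> q \<and> q1 \<in> V}"
  define Wb where "Wb = {q \<in> X. \<exists>q1\<in>X. \<exists>q2\<in>X. q1 < q2 \<and> q2 \<le> q \<and> q1 \<in> V \<and> q2 \<notin> V}"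
  define Wc where "Wc = {q \<in> X. \<exists>q1\<in>X. \<exists>q2\<in>X. \<exists>q3\<in>X.
    q1 < q2 \<and> q2 < q3 \<and> q3 \<le> q \<and> q1 \<in> V \<and> q2 \<notin> V \<and> q3 \<in> V}"
  have 1: "Wc \<subseteq> Wb" unfolding Wb_def Wc_def by (blast intro: less_imp_le less_le_trans)
  have 2: "Wb \<subseteq> Wa" unfolding Wa_def Wb_def by (blast intro: less_imp_le less_le_trans)
  have 3: "\<forall>W\<in>{Wa, Wb, Wc}. \<forall>w\<in>W. \<forall>q\<in>X. w \<le> q \<longrightarrow> q \<in> W"
    unfolding Wa_def Wb_def Wc_def by simp (meson order_trans)
  have 4: "q \<in> V \<longleftrightarrow> q \<in> Wa \<and> q \<notin> Wb \<or> q \<in> Wc" if q: "q \<in> X" for q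
  proof (cases "q \<in> V")
    case True
    then have "q \<in> Wa" using q unfolding Wa_def by blast
    moreover have "q \<in> Wc" if "q \<in> Wb"
    proof -
      from that obtain q1 q2 where *: "q1 \<in> X" "q2 \<in> X" "q1 < q2" "q2 \<le> q" "q1 \<in> V" "q2 \<notin> V"
        unfolding Wb_def by blast
      then have "q2 < q" using True by (metis less_le)
      then show ?thesis using * q True unfolding Wc_def by blast
    qed
    ultimately show ?thesis using True by blast
  next
    case False
    have "q \<in> Wb" if "q \<in> Wa"
    proof -
      from that obtain q1 where "q1 \<in> X" "q1 \<le> q" "q1 \<in> V" unfolding Wa_def by blast
      moreover from this have "q1 < q" using False by (metis less_le)
      ultimately show ?thesis using q False unfolding Wb_def by blast
    qed
    moreover have "q \<notin> Wc"
    proof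
      assume "q \<in> Wc"
      then obtain q1 q2 q3 where *: "q1 \<in> X" "q2 \<in> X" "q3 \<in> X" "q1 < q2" "q2 < q3" "q3 \<le> q"
        "q1 \<in> V" "q2 \<notin> V" "q3 \<in> V" unfolding Wc_def by blast
      then have "q3 < q" using False by (metis less_le)
      then show False using assms * q False unfolding alternates_def by blast
    qed
    ultimately show ?thesis using False by blast
  qed
  show ?thesis
    by (rule exI[of _ Wa], rule exI[of _ Wb], rule exI[of _ Wc]) (intro conjI ballI 1 2 3 4)
qed

text \<open>\<open>a\<close>, \<open>b\<close>, \<open>c\<close> realise the cuts of the three final
  segments and depend on none of \<open>f\<close>, \<open>e\<close>, \<open>T\<close>,
  \<open>x\<close>, which later makes the operator linear. Since a single point \<open>x\<close>
  realises the cut of \<open>V\<close> on \<open>T\<close>, one neighbouring pair of segments agrees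
  on \<open>T\<close>; its two terms nearly cancel and the remaining one is close to
  \<open>f x\<close>.\<close>

lemma ex_three_points:
  fixes X :: "'a::linorder_topology set"
  assumes compact: "compact (UNIV :: 'a set)" and "\<not> alternates V X"
  shows "\<exists>a b c. \<forall>(f :: 'a \<Rightarrow> real) e T x. T \<subseteq> X \<longrightarrow> cut_at T V x \<longrightarrow>
    (\<forall>U z z'. cut_at T U z \<longrightarrow> cut_at T U z' \<longrightarrow> \<bar>f z - f z'\<bar> < e) \<longrightarrow>
    \<bar>f a - f b + f c - f x\<bar> < 2 * e"
proof -
  obtain Wa Wb Wc where W: "Wc \<subseteq> Wb" "Wb \<subseteq> Wa"
    and up: "\<And>W w q. W \<in> {Wa, Wb, Wc} \<Longrightarrow> w \<in> W \<Longrightarrow> q \<in> X \<Longrightarrow> w \<le> q \<Longrightarrow> q \<in> W"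
    and V: "\<And>q. q \<in> X \<Longrightarrow> q \<in> V \<longleftrightarrow> q \<in> Wa \<and> q \<notin> Wb \<or> q \<in> Wc"
    using not_alternates_decomp[OF assms(2)] by metis
  obtain a where a: "cut_at X Wa a" using ex_cut_at[OF compact, of Wa X] up by blast
  obtain b where b: "cut_at X Wb b" using ex_cut_at[OF compact, of Wb X] up by blast
  obtain c where c: "cut_at X Wc c" using ex_cut_at[OF compact, of Wc X] up by blast
  have "\<bar>f a - f b + f c - f x\<bar> < 2 * e"
    if T: "T \<subseteq> X" and x: "cut_at T V x"
      and osc: "\<And>U z z'. cut_at T U z \<Longrightarrow> cut_at T U z' \<Longrightarrow> \<bar>f z - f z'\<bar> < e" 
    for f :: "'a \<Rightarrow> real" and e T x
  proof -
    have abc: "cut_at T Wa a" "cut_at T Wb b" "cut_at T Wc c"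
      using a b c T cut_at_mono by blast+
    show ?thesis
    proof (cases "T \<inter> Wb = T \<inter> Wc")
      case True
      then have "T \<inter> V = T \<inter> Wa" using V W T by blast
      then have "cut_at T Wa x" "cut_at T Wb c" using x abc(3) True cut_at_cong by blast+
      then have "\<bar>f a - f x\<bar> < e" "\<bar>f b - f c\<bar> < e" using osc abc by blast+
      then show ?thesis by linarith
    next
      case False
      then obtain q where q: "q \<in> T" "q \<in> Wb" "q \<notin> Wc" using W by blast
      then have "q \<notin> V" using V T by blast
      then have qx: "q \<le> x" using x q unfolding cut_at_def by blast
      \<comment> \<open>Otherwise \<open>r\<close> is in \<open>V\<close>, so
        \<open>q \<le> x \<le> r\<close>, and \<open>r\<close> follows \<open>q\<close> into the
        final segment \<open>Wb\<close>.\<close>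
      have "r \<in> Wb" if "r \<in> T" "r \<in> Wa" for r
      proof (rule ccontr)
        assume "r \<notin> Wb"
        then have "r \<in> V" using V that T by blast
        then have "x \<le> r" using x that unfolding cut_at_def by blast
        then show False using up[of Wb q r] q order_trans[OF qx] that T \<open>r \<notin> Wb\<close> by auto
      qed
      then have ab: "T \<inter> Wa = T \<inter> Wb" using W by blast
      then have "T \<inter> V = T \<inter> Wc" using V W T by blast
      then have "cut_at T Wc x" "cut_at T Wb a" using x abc(1) ab cut_at_cong by blast+
      then have "\<bar>f c - f x\<bar> < e" "\<bar>f a - f b\<bar> < e" using osc abc by blast+
      then show ?thesis by linarith
    qed
  qed
  then show ?thesis by blast
qed

section \<open>Traces of cuts in the extension\<close>

text \<open>Countable families leave no gap, by diagonalisation: from each \<open>B\<close> keep the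
  points lying in all \<open>C\<close> enumerated no later than \<open>B\<close>. Each
  \<open>B\<close> loses only finitely many finite differences, and only finitely many
  \<open>B\<close> contribute points outside a given \<open>C\<close>.\<close>

lemma ex_almost_between:
  assumes count: "countable \<B>" "countable \<C>"
    and fin: "\<And>B C. B \<in> \<B> \<Longrightarrow> C \<in> \<C> \<Longrightarrow> finite (B - C)"
  shows "\<exists>A\<subseteq>\<Union>\<B>. (\<forall>B\<in>\<B>. finite (B - A)) \<and> (\<forall>C\<in>\<C>. finite (A - C))"
proof -
  let ?s = "to_nat_on \<B>" and ?t = "to_nat_on \<C>"
  define A where "A = {x. \<exists>B\<in>\<B>. x \<in> B \<and> (\<forall>C\<in>\<C>. ?t C \<le> ?s B \<longrightarrow> x \<in> C)}"
  have fin_initial: "finite {S \<in> \<S>. to_nat_on \<S> S \<le> k}" if "countable \<S>" for \<S> :: "'a set set" and k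
    by (rule finite_imageD[of "to_nat_on \<S>"], rule finite_subset[of _ "{..k}"])
      (use that in \<open>auto intro: inj_on_subset[OF inj_on_to_nat_on]\<close>)
  have "finite (B - A)" if B: "B \<in> \<B>" for B
  proof (rule finite_subset)
    show "B - A \<subseteq> (\<Union>C\<in>{C \<in> \<C>. ?t C \<le> ?s B}. B - C)" using B unfolding A_def by blast
    show "finite (\<Union>C\<in>{C \<in> \<C>. ?t C \<le> ?s B}. B - C)"
      using fin[OF B] by (intro finite_UN_I fin_initial[OF count(2)]) auto
  qed
  moreover have "finite (A - C)" if C: "C \<in> \<C>" for C
  proof (rule finite_subset)
    show "A - C \<subseteq> (\<Union>B\<in>{B \<in> \<B>. ?s B \<le> ?t C}. B - C)"
    proof
      fix x assume x: "x \<in> A - C"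
      then obtain B where B: "B \<in> \<B>" "x \<in> B" "\<forall>C\<in>\<C>. ?t C \<le> ?s B \<longrightarrow> x \<in> C"
        unfolding A_def by blast
      then have "\<not> ?t C \<le> ?s B" using C x by blast
      then show "x \<in> (\<Union>B\<in>{B \<in> \<B>. ?s B \<le> ?t C}. B - C)" using B x by auto
    qed
    show "finite (\<Union>B\<in>{B \<in> \<B>. ?s B \<le> ?t C}. B - C)"
      using fin[OF _ C] by (intro finite_UN_I fin_initial[OF count(1)]) auto
  qed
  moreover have "A \<subseteq> \<Union>\<B>" unfolding A_def by blast
  ultimately show ?thesis by blast
qed

lemma open_singleton_discrete:
  assumes "open N" "discrete N" "y \<in> N"
  shows "open {y}"
proof -
  obtain T where "open T" "T \<inter> N = {y}"
    using discreteD[OF assms(2,3)] by (rule isolated_inE)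
  then show ?thesis using assms(1) by (metis open_Int)
qed

text \<open>The closure is compact and covered by open singletons.\<close>

lemma finite_discrete_closure:
  fixes N :: "'b::t2_space set"
  assumes "compact (UNIV :: 'b set)" "open N" "discrete N" "closure B \<subseteq> N"
  shows "finite B"
proof -
  have "compact (closure B)"
    using compact_Int_closed[OF assms(1), of "closure B"] by simp
  then obtain I where "finite I" "closure B \<subseteq> (\<Union>y\<in>I. {y})"
  proof (rule compactE_image[of "closure B" "closure B" "\<lambda>y. {y}"])
    show "open {y}" if "y \<in> closure B" for y
      using open_singleton_discrete[OF assms(2,3)] assms(4) that by auto
  qed auto
  then show ?thesis using closure_subset[of B] by (auto intro: finite_subset)
qed

lemma compact_separation:
  fixes S T :: "'b::t2_space set"
  assumes "compact S" "compact T" "S \<inter> T = {}"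
  obtains U V where "open U" "open V" "S \<subseteq> U" "T \<subseteq> V" "U \<inter> V = {}"
proof -
  have "Hausdorff_space (euclidean :: 'b topology)"
    unfolding Hausdorff_space_def disjnt_def using hausdorff by (simp, blast)
  then show ?thesis
    using Hausdorff_space_compact_separation[of euclidean S T] that assms
    by (auto simp: disjnt_def)
qed

section \<open>Sets of isolated points lying to the left of a cut\<close>

locale compact_line_extension =
  fixes i :: "'a::linorder_topology \<Rightarrow> 'b::t2_space" and N :: "'b set"
  assumes compact_dom: "compact (UNIV :: 'a set)"
    and extension: "countable_discrete_extension i"
    and N_def: "N = - range i"
begin

lemma compact_cod: "compact (UNIV :: 'b set)"
  and countable_N: "countable N" and discrete_N: "discrete N"
  and emb: "embedding_map euclidean euclidean i"
  using extension unfolding countable_discrete_extension_def N_def by auto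

lemma inj_i: "inj i"
  using emb unfolding embedding_map_def by (auto dest: homeomorphic_imp_injective_map)

lemma continuous_i: "continuous_on UNIV i"
  using homeomorphic_imp_continuous_map[OF emb[unfolded embedding_map_def]]
  by (simp add: continuous_map_in_subtopology)

lemma open_N: "open N"
  using compact_imp_closed[OF compact_continuous_image[OF continuous_i compact_dom]]
  unfolding N_def by (rule open_Compl)

lemma finite_if_no_limit:
  assumes "\<And>z. i z \<notin> closure B"
  shows "finite B"
  using assms by (intro finite_discrete_closure[OF compact_cod open_N discrete_N]) (auto simp: N_def)

lemma open_image: 
  assumes "open S"
  obtains W where "open W" "i ` S = W \<inter> range i"
proof -
  have "openin (top_of_set (range i)) (i ` S)"
    using homeomorphic_imp_open_map[OF emb[unfolded embedding_map_def]] assms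
    unfolding open_map_def by simp
  then show ?thesis using that unfolding openin_open by (metis inf_commute)
qed

text \<open>The images of \<open>{..x}\<close> and \<open>{y..}\<close> have disjoint open
  neighbourhoods \<open>U\<close> and \<open>V\<close>. For \<open>N \<inter> U\<close> the closure
  misses \<open>V\<close>, and the closure of the rest of \<open>N\<close> misses
  \<open>U\<close>.\<close>

lemma ex_separating_trace:
  assumes "x < y"
  shows "\<exists>B\<subseteq>N. (\<forall>z. i z \<in> closure B \<longrightarrow> z < y) \<and> (\<forall>z. i z \<in> closure (N - B) \<longrightarrow> x < z)"
proof -
  have "compact (i ` S)" if "closed S" for S
    using compact_continuous_image[of S i] compact_Int_closed[OF compact_dom that] continuous_i
      continuous_on_subset by (metis inf_top.left_neutral subset_UNIV)
  then have "compact (i ` {..x})" "compact (i ` {y..})" by auto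
  moreover have "i ` {..x} \<inter> i ` {y..} = {}" using assms inj_i by (auto dest: injD)
  ultimately obtain U V where UV: "open U" "open V" "i ` {..x} \<subseteq> U" "i ` {y..} \<subseteq> V" "U \<inter> V = {}"
    using compact_separation by metis
  have 1: "closure (N \<inter> U) \<subseteq> - V" using UV by (intro closure_minimal) auto
  have 2: "closure (N - N \<inter> U) \<subseteq> - U" using UV by (intro closure_minimal) auto
  have "z < y" if z: "i z \<in> closure (N \<inter> U)" for z
  proof (rule ccontr)
    assume "\<not> z < y"
    then have "i z \<in> V" using UV(4) by (auto simp: not_less)
    then show False using z 1 by blast
  qed
  moreover have "x < z" if z: "i z \<in> closure (N - N \<inter> U)" for z
  proof (rule ccontr)
    assume "\<not> x < z"
    then have "i z \<in> U" using UV(3) by (auto simp: not_less)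
    then show False using z 2 by blast
  qed
  ultimately show ?thesis by (intro exI[of _ "N \<inter> U"]) auto
qed

text \<open>The clause for jumps matches \<open>cut_at\<close>: at any other \<open>q\<close>, the
  point \<open>i q\<close> may be a limit of both \<open>B\<close> and \<open>N - B\<close>.\<close>

definition trace_at :: "'a \<Rightarrow> 'b set \<Rightarrow> bool" where
  "trace_at q B \<longleftrightarrow> B \<subseteq> N \<and> (\<forall>z. i z \<in> closure B \<longrightarrow> z \<le> q) \<and>
     (\<forall>z. i z \<in> closure (N - B) \<longrightarrow> q \<le> z \<and> (jump q \<longrightarrow> q < z))"

text \<open>A finite subset of \<open>N\<close> is closed and contributes no limit in the image of
  \<open>i\<close>.\<close>

lemma closure_almost_subset:
  assumes "i z \<in> closure A" "A \<subseteq> N" "finite (A - B)"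
  shows "i z \<in> closure B"
proof -
  have "closure A \<subseteq> closure (B \<union> (A - B))" by (intro closure_mono) auto
  also have "\<dots> = closure B \<union> (A - B)"
    using assms(3) by (simp only: closure_Un closure_closed[OF finite_imp_closed])
  finally show ?thesis using assms(1,2) by (auto simp: N_def)
qed

text \<open>A limit \<open>i z\<close> of the difference would give \<open>z \<le> q\<close> from
  \<open>B\<close> and \<open>q' \<le> z\<close> from the complement of \<open>B'\<close>; a subset
  of \<open>N\<close> without such limits is finite.\<close>

lemma trace_at_finite_diff:
  assumes "trace_at q B" "trace_at q' B'" "q < q'"
  shows "finite (B - B')"
proof (rule finite_if_no_limit)
  fix z
  have "B - B' \<subseteq> N - B'" using assms(1) unfolding trace_at_def by blast
  then have "i z \<in> closure B" "i z \<in> closure (N - B')" if "i z \<in> closure (B - B')"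
    using closure_mono[of "B - B'" B] closure_mono[of "B - B'" "N - B'"] that by blast+
  then show "i z \<notin> closure (B - B')"
    using assms unfolding trace_at_def by force
qed

text \<open>At a jump, separate \<open>q\<close> from its successor. Otherwise separate
  \<open>q\<close> from countably many points approaching it on either side, and interpolate between
  the two countable families of sets.\<close>

lemma ex_trace_at:
  assumes D: "countable D" "\<And>x y :: 'a. {x<..<y} \<noteq> {} \<Longrightarrow> {x<..<y} \<inter> D \<noteq> {}"
  shows "\<exists>B. trace_at q B"
proof (cases "jump q")
  case True
  then obtain s where s: "q < s" "{q<..<s} = {}" unfolding jump_def by blast
  obtain B where "B \<subseteq> N" "\<And>z. i z \<in> closure B \<Longrightarrow> z < s" "\<And>z. i z \<in> closure (N - B) \<Longrightarrow> q < z"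
    using ex_separating_trace[OF s(1)] by blast
  moreover have "z \<le> q" if "z < s" for z using that s(2) unfolding empty_interval_iff by (metis not_less)
  ultimately have "trace_at q B" unfolding trace_at_def by (blast intro: less_imp_le)
  then show ?thesis by blast
next
  case False
  \<comment> \<open>An immediate predecessor of \<open>q\<close> is included because
    \<open>D\<close> may miss it; there is at most one, so \<open>X\<close> stays countable.\<close>
  define X where "X = {x. x < q \<and> (x \<in> D \<or> {x<..<q} = {})}"
  define Y where "Y = {y \<in> D. q < y}"
  have "finite {x. x < q \<and> {x<..<q} = {}}"
  proof -
    have unique: "x = x'" if "x < q" "{x<..<q} = {}" "x' < q" "{x'<..<q} = {}" for x x'
      using that by (metis empty_iff greaterThanLessThan_iff linorder_neqE)
    show ?thesis
    proof (cases "\<exists>x. x < q \<and> {x<..<q} = {}")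
      case True
      then obtain x where "x < q" "{x<..<q} = {}" by blast
      then have "y = x" if "y < q" "{y<..<q} = {}" for y using unique[of y x] that by simp
      then have "{x. x < q \<and> {x<..<q} = {}} \<subseteq> {x}" by blast
      then show ?thesis by (rule finite_subset) simp
    next
      case False
      then have "{x. x < q \<and> {x<..<q} = {}} = {}" by blast
      then show ?thesis by (simp only: finite.emptyI)
    qed
  qed
  then have "countable (D \<union> {x. x < q \<and> {x<..<q} = {}})"
    using D(1) countable_finite by blast
  moreover have "X \<subseteq> D \<union> {x. x < q \<and> {x<..<q} = {}}" unfolding X_def by blast
  ultimately have X: "countable X" using countable_subset by blast
  have Y: "countable Y" unfolding Y_def using D(1) by simp
  have "\<exists>B\<subseteq>N. (\<forall>z. i z \<in> closure B \<longrightarrow> z < q) \<and> (\<forall>z. i z \<in> closure (N - B) \<longrightarrow> x < z)" if "x \<in> X" for x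
    by (rule ex_separating_trace) (use that in \<open>simp add: X_def\<close>)
  then obtain B where B: "\<And>x. x \<in> X \<Longrightarrow> B x \<subseteq> N" "\<And>x z. x \<in> X \<Longrightarrow> i z \<in> closure (B x) \<Longrightarrow> z < q"
    "\<And>x z. x \<in> X \<Longrightarrow> i z \<in> closure (N - B x) \<Longrightarrow> x < z" by metis
  have "\<exists>C\<subseteq>N. (\<forall>z. i z \<in> closure C \<longrightarrow> z < y) \<and> (\<forall>z. i z \<in> closure (N - C) \<longrightarrow> q < z)" if "y \<in> Y" for y
    by (rule ex_separating_trace) (use that in \<open>simp add: Y_def\<close>)
  then obtain C where C: "\<And>y. y \<in> Y \<Longrightarrow> C y \<subseteq> N" "\<And>y z. y \<in> Y \<Longrightarrow> i z \<in> closure (C y) \<Longrightarrow> z < y"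
    "\<And>y z. y \<in> Y \<Longrightarrow> i z \<in> closure (N - C y) \<Longrightarrow> q < z" by metis
  \<comment> \<open>A limit of this difference would lie both strictly below and strictly above
    \<open>q\<close>.\<close>
  have fin: "finite (B x - C y)" if "x \<in> X" "y \<in> Y" for x y
  proof (rule finite_if_no_limit)
    fix z
    have "B x - C y \<subseteq> N - C y" using B(1) that by blast
    then have "i z \<in> closure (B x)" "i z \<in> closure (N - C y)" if "i z \<in> closure (B x - C y)"
      using closure_mono[of "B x - C y" "B x"] closure_mono[of "B x - C y" "N - C y"] that by blast+
    then show "i z \<notin> closure (B x - C y)" using B(2)[of x z] C(3)[of y z] that by force
  qed
  have "finite (S - S')" if "S \<in> B ` X" "S' \<in> C ` Y" for S S' using fin that by auto
  note ex_almost_between[OF countable_image[OF X] countable_image[OF Y] this]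
  then obtain A where "A \<subseteq> \<Union>(B ` X) \<and> (\<forall>S\<in>B ` X. finite (S - A)) \<and> (\<forall>S\<in>C ` Y. finite (A - S))" ..
  then have A: "A \<subseteq> \<Union>(B ` X)" "\<And>x. x \<in> X \<Longrightarrow> finite (B x - A)" "\<And>y. y \<in> Y \<Longrightarrow> finite (A - C y)"
    by auto
  have AN: "A \<subseteq> N" using A(1) B(1) by blast
  have "z \<le> q" if z: "i z \<in> closure A" for z
  proof (rule ccontr)
    assume "\<not> z \<le> q"
    \<comment> \<open>Since \<open>q\<close> is not a jump, \<open>D\<close> supplies a point
      \<open>y\<close> between \<open>q\<close> and \<open>z\<close>, and \<open>A\<close> is almost
      contained in \<open>C y\<close>.\<close>
    then have "{q<..<z} \<noteq> {}" using False unfolding jump_def by auto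
    then have "{q<..<z} \<inter> D \<noteq> {}" by (rule D(2))
    then obtain y where y: "y \<in> Y" "y < z" unfolding Y_def by force
    then have "i z \<in> closure (C y)" using closure_almost_subset[OF z AN A(3)] by simp
    then show False using C(2) y by force
  qed
  moreover have "q \<le> z" if z: "i z \<in> closure (N - A)" for z
  proof (rule ccontr)
    assume "\<not> q \<le> z"
    obtain x where x: "x \<in> X" "z \<le> x"
    proof (cases "{z<..<q} = {}")
      case True
      then show ?thesis using that[of z] \<open>\<not> q \<le> z\<close> unfolding X_def by simp
    next
      case False
      then have "{z<..<q} \<inter> D \<noteq> {}" by (rule D(2))
      then obtain x where "x \<in> D" "z < x" "x < q" by force
      then show ?thesis using that[of x] unfolding X_def by simp
    qed
    have "N - A - (N - B x) \<subseteq> B x - A" by blast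
    then have "finite (N - A - (N - B x))" using A(2)[OF x(1)] by (rule finite_subset)
    then have "i z \<in> closure (N - B x)" using closure_almost_subset[OF z] by auto
    then show False using B(3) x by force
  qed
  ultimately have "trace_at q A" unfolding trace_at_def using AN False by blast
  then show ?thesis by blast
qed

end

section \<open>The extension operator\<close>

context
  includes cardinal_syntax
begin

text \<open>Complements of points are open, and a finite basis has only finitely many
  unions.\<close>

lemma finite_topological_basis_imp_finite:
  fixes \<B> :: "'a::t1_space set set"
  assumes "topological_basis \<B>" "finite \<B>"
  shows "finite (UNIV :: 'a set)"
proof -
  have "range (\<lambda>x. - {x} :: 'a set) \<subseteq> Union ` Pow \<B>"
  proof (rule image_subsetI)
    fix x :: 'a
    have "open (- {x})" by (rule open_Compl) simp
    then obtain \<B>' where "\<B>' \<subseteq> \<B>" "\<Union>\<B>' = - {x}"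
      using assms(1)[unfolded topological_basis_def, THEN conjunct2, THEN spec[of _ "- {x}"]] by auto
    then show "- {x} \<in> Union ` Pow \<B>" by (intro image_eqI[of _ _ \<B>']) simp_all
  qed
  then have "finite (range (\<lambda>x. - {x} :: 'a set))"
    by (rule finite_subset) (simp add: assms(2))
  moreover have "inj (\<lambda>x. - {x} :: 'a set)" by (rule injI) simp
  ultimately show ?thesis using finite_imageD by blast
qed

text \<open>At a jump \<open>q\<close> the ray \<open>{..q}\<close> is open, so some basic set has
  \<open>q\<close> as its maximum; distinct jumps get distinct basic sets. The countable
  \<open>D\<close> is absorbed because the basis is infinite.\<close>

lemma jumps_ordLeq_weight:
  fixes \<kappa> :: "'k rel" and D :: "'a::linorder_topology set"
  assumes w: "has_weight TYPE('a) \<kappa>" and D: "countable D" and inf: "infinite ({q. jump q} \<union> D)"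
  shows "|{q. jump q} \<union> D| \<le>o \<kappa>"
proof -
  obtain \<B> :: "'a set set" where \<B>: "topological_basis \<B>" "|\<B>| =o \<kappa>"
    using w unfolding has_weight_def by blast
  have infB: "infinite \<B>"
  proof
    assume "finite \<B>"
    with \<B>(1) have "finite (UNIV :: 'a set)" by (rule finite_topological_basis_imp_finite)
    then have "finite ({q. jump q} \<union> D)" by (rule rev_finite_subset) simp
    with inf show False by contradiction
  qed
  have "\<exists>U\<in>\<B>. q \<in> U \<and> U \<subseteq> {..q}" if "jump q" for q
  proof -
    obtain s where "q < s" "{q<..<s} = {}" using \<open>jump q\<close> unfolding jump_def by blast
    then have "{..q} = {..<s}" unfolding empty_interval_iff by (auto simp: not_less intro: le_less_trans)
    then have "open {..q}" by simp
    then show ?thesis using topological_basisE[OF \<B>(1), of "{..q}" q] by (metis atMost_iff order_refl)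
  qed
  then obtain u where u: "\<And>q. jump q \<Longrightarrow> u q \<in> \<B> \<and> q \<in> u q \<and> u q \<subseteq> {..q}" by metis
  have inj_u: "inj_on u {q. jump q}"
  proof (rule inj_onI)
    fix q q' assume "q \<in> {q. jump q}" "q' \<in> {q. jump q}" "u q = u q'"
    then have "q \<le> q'" "q' \<le> q" using u[of q] u[of q'] by auto
    then show "q = q'" by simp
  qed
  have J: "|{q :: 'a. jump q}| \<le>o |\<B>|" 
    unfolding card_of_ordLeq[symmetric] using inj_u u by (intro exI[of _ u]) auto
  have "|D| \<le>o |UNIV :: nat set|" 
    unfolding card_of_ordLeq[symmetric] using inj_on_to_nat_on[OF D] by blast
  then have "|D| \<le>o |\<B>|" using infB infinite_iff_card_of_nat ordLeq_transitive by blast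
  with J have "|{q. jump q} \<union> D| \<le>o |\<B>|"
    using infB by (intro card_of_Un_ordLeq_infinite_Field card_of_Card_order) (auto simp: Field_card_of)
  then show ?thesis using \<B>(2) by (rule ordLeq_ordIso_trans)
qed

end

section \<open>Evaluation points and continuity\<close>

lemma (in compact_line_extension) ex_evaluation_points:
  fixes \<kappa> :: "'k rel"
  assumes \<kappa>: "Card_order \<kappa>" "martins_axiom \<kappa>" "has_weight TYPE('a) \<kappa>"
    and sep: "separable_space (euclidean :: 'a topology)"
  shows "\<exists>a b c. \<forall>f :: 'a \<Rightarrow> real. continuous_on UNIV f \<longrightarrow>
    continuous_on UNIV (\<lambda>y. if y \<in> N then f (a y) - f (b y) + f (c y) else f (inv i y))"
proof -
  obtain D :: "'a set" where D: "countable D" "closure D = UNIV"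
    using sep unfolding separable_space_def by auto
  have dense: "{x<..<y} \<inter> D \<noteq> {}" if "{x<..<y} \<noteq> {}" for x y
    using open_Int_closure_eq_empty[of "{x<..<y}" D] that D(2) by auto
  define Q where "Q = {q. jump q} \<union> D"
  have "\<exists>A. \<forall>q. trace_at q (A q)" using ex_trace_at[OF D(1) dense] by metis
  then obtain A where A: "\<And>q. trace_at q (A q)" by blast
  have AN: "A q \<subseteq> N" for q using A[of q] unfolding trace_at_def by blast
  let ?e = "to_nat_on N"
  have e_mem: "?e y \<in> ?e ` A q \<longleftrightarrow> y \<in> A q" if "y \<in> N" for y q
    using inj_on_image_mem_iff[OF inj_on_to_nat_on[OF countable_N] that AN] .
  obtain g where g: "\<And>n. \<not> alternates {q. n \<in> ?e ` A q} {q \<in> Q. g q \<le> n}"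
  proof -
    have "\<exists>g. \<forall>n. \<not> alternates {q. n \<in> ?e ` A q} {q \<in> Q. g q \<le> n}"
    proof (rule ex_alternation_free_rank[OF \<kappa>(1,2)])
      show "ordLeq3 (card_of Q) \<kappa>" if "infinite Q"
        using jumps_ordLeq_weight[OF \<kappa>(3) D(1)] that unfolding Q_def .
      show "finite (?e ` A q - ?e ` A q')" if "q < q'" for q q'
      proof (rule finite_subset)
        show "?e ` A q - ?e ` A q' \<subseteq> ?e ` (A q - A q')" by blast
        show "finite (?e ` (A q - A q'))" using trace_at_finite_diff[OF A A that] by simp
      qed
      show "\<exists>r\<in>D. q < r \<and> r \<le> q'" if "q' \<in> Q" "q < q'" for q q'
      proof (cases "q' \<in> D")
        case False
        then have "jump q'" using that(1) unfolding Q_def by blast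
        then obtain s where s: "q' < s" "{q'<..<s} = {}" unfolding jump_def by blast
        \<comment> \<open>The interval contains \<open>q'\<close>, so \<open>D\<close> meets it; a
          point below the successor \<open>s\<close> of \<open>q'\<close> is at most
          \<open>q'\<close>.\<close>
        then have "{q<..<s} \<noteq> {}" using that(2) unfolding empty_interval_iff by (metis not_less)
        then have "{q<..<s} \<inter> D \<noteq> {}" by (rule dense)
        then obtain r where r: "r \<in> D" "q < r" "r < s" by force
        then have "r \<le> q'" using s(2) unfolding empty_interval_iff by (metis not_less)
        then show ?thesis using r by blast
      qed (use that in auto)
    qed (use D in \<open>auto simp: Q_def\<close>)
    then show ?thesis using that by blast
  qed
  define X where "X y = {q \<in> Q. g q \<le> ?e y}" for y
  define V where "V y = {q. y \<in> A q}" for y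
  have no_alt: "\<not> alternates (V y) (X y)" if "y \<in> N" for y
    using g[of "?e y"] e_mem[OF that] unfolding V_def X_def by simp
  define approx where "approx y a b c \<longleftrightarrow> (\<forall>(f :: 'a \<Rightarrow> real) e T x. T \<subseteq> X y \<longrightarrow> cut_at T (V y) x \<longrightarrow>
      (\<forall>U z z'. cut_at T U z \<longrightarrow> cut_at T U z' \<longrightarrow> \<bar>f z - f z'\<bar> < e) \<longrightarrow>
      \<bar>f a - f b + f c - f x\<bar> < 2 * e)" for y a b c
  have "\<exists>a b c. approx y a b c" if "y \<in> N" for y
    unfolding approx_def by (rule ex_three_points[OF compact_dom no_alt[OF that]])
  then obtain a b c where abc: "\<And>y. y \<in> N \<Longrightarrow> approx y (a y) (b y) (c y)" by metis
  have "continuous_on UNIV (\<lambda>y. if y \<in> N then f (a y) - f (b y) + f (c y) else f (inv i y))"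
    (is "continuous_on UNIV ?F") if f: "continuous_on UNIV f" for f :: "'a \<Rightarrow> real"
  proof -
    have "\<forall>\<^sub>F y' in at y. dist (?F y') (?F y) < e" if e: "0 < e" for e y
    proof (cases "y \<in> N")
      case True
      then have "open {y}" using open_singleton_discrete[OF open_N discrete_N] by blast
      then show ?thesis unfolding eventually_at_topological by (intro exI[of _ "{y}"]) auto
    next
      case False
      then obtain x where x: "y = i x" unfolding N_def by auto
      \<comment> \<open>The tolerance is halved because the three-point estimate doubles it.\<close>
      have "\<exists>T. finite T \<and> T \<subseteq> Q \<and> (\<forall>U z z'. cut_at T U z \<longrightarrow> cut_at T U z' \<longrightarrow> \<bar>f z - f z'\<bar> < e / 2)"
      proof (rule ex_finite_cuts[OF compact_dom _ _ f])
        show "q \<in> Q" if "jump q" for q using that unfolding Q_def by simp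
        show "{x<..<y} \<inter> Q \<noteq> {}" if "{x<..<y} \<noteq> {}" for x y using dense[OF that] unfolding Q_def by auto
        show "0 < e / 2" using e by simp
      qed
      then obtain T where T: "finite T" "T \<subseteq> Q"
        and osc: "\<forall>U z z'. cut_at T U z \<longrightarrow> cut_at T U z' \<longrightarrow> \<bar>f z - f z'\<bar> < e / 2"
        by blast
      have "open (f -` ball (f x) e)" using f by (auto simp: open_vimage)
      then obtain W where W: "open W" "i ` (f -` ball (f x) e) = W \<inter> range i"
        by (rule open_image)
      \<comment> \<open>Outside \<open>Z\<close>, a point of \<open>N\<close> lies, for each cut in
        \<open>T\<close>, on a side that accumulates at \<open>y\<close>.\<close>
      define Z where "Z = \<Union>(closure ` {S \<in> A ` T \<union> (\<lambda>q. N - A q) ` T. y \<notin> closure S})"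
      \<comment> \<open>These finitely many points have an index below some rank on
        \<open>T\<close>; for every other \<open>y'\<close> in \<open>N\<close>, all of
        \<open>T\<close> lies in \<open>X y'\<close>.\<close>
      define F where "F = {y' \<in> N. \<exists>q\<in>T. ?e y' < g q}"
      have "finite {S \<in> A ` T \<union> (\<lambda>q. N - A q) ` T. y \<notin> closure S}" using T(1) by simp
      then have "closed Z" unfolding Z_def by (intro closed_Union finite_imageI) auto
      have "?e ` F \<subseteq> (\<Union>q\<in>T. {..<g q})" unfolding F_def by blast
      then have "finite (?e ` F)" by (rule finite_subset) (use T(1) in auto)
      moreover have "inj_on ?e F"
        using inj_on_to_nat_on[OF countable_N] by (rule inj_on_subset) (auto simp: F_def)
      ultimately have "finite F" by (rule finite_imageD)
      then have "closed F" by (rule finite_imp_closed)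
      with \<open>closed Z\<close> W(1) have "open (W - Z - F)" by (intro open_Diff)
      moreover have "y \<in> W - Z - F"
      proof -
        have "y \<in> i ` (f -` ball (f x) e)" using x e by auto
        then have "y \<in> W" using W(2) by blast
        moreover have "y \<notin> Z" unfolding Z_def by blast
        moreover have "y \<notin> F" using False unfolding F_def by blast
        ultimately show ?thesis by blast
      qed
      moreover have "dist (?F y') (?F y) < e" if y': "y' \<in> W - Z - F" for y'
      proof (cases "y' \<in> N")
        case True
        have "T \<subseteq> X y'" using T(2) y' True unfolding X_def F_def by force
        moreover have "cut_at T (V y') x"
          unfolding cut_at_def
        proof
          fix q assume q: "q \<in> T"
          \<comment> \<open>For each \<open>q\<close> the side containing \<open>y'\<close>
            accumulates at \<open>i x\<close>, so by \<open>trace_at\<close> the point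
            \<open>x\<close> realises the cut that \<open>y'\<close> makes on
            \<open>T\<close>.\<close>
          have lim: "y \<in> closure S" if "S \<in> A ` T \<union> (\<lambda>q. N - A q) ` T" "y' \<in> S" for S
            using that y' closure_subset[of S] unfolding Z_def by blast
          have "y \<in> closure (A q)" if "y' \<in> A q"
            using lim[OF _ that] q by simp
          moreover have "y \<in> closure (N - A q)" if "y' \<notin> A q"
            using lim[of "N - A q"] q True that by simp
          ultimately show "(q \<in> V y' \<longrightarrow> x \<le> q) \<and> (q \<notin> V y' \<longrightarrow> q \<le> x \<and> (jump q \<longrightarrow> q < x))"
            using A[of q] unfolding trace_at_def x V_def by blast
        qed
        ultimately have "\<bar>f (a y') - f (b y') + f (c y') - f x\<bar> < 2 * (e / 2)"
          using abc[OF True] osc unfolding approx_def by blast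
        then show ?thesis using True False x inj_i by (simp add: dist_real_def)
      next
        case y'N: False
        then obtain x' where x': "y' = i x'" unfolding N_def by auto
        then have "i x' \<in> i ` (f -` ball (f x) e)" using y' W(2) by blast
        then have "x' \<in> f -` ball (f x) e" using inj_i by (metis inj_image_mem_iff)
        then show ?thesis using False y'N x x' inj_i by (simp add: dist_commute)
      qed
      ultimately show ?thesis unfolding eventually_at_topological by blast
    qed
    then have "(?F \<longlongrightarrow> ?F y) (at y)" for y unfolding tendsto_iff by blast
    then show ?thesis by (simp add: continuous_on_def)
  qed
  then show ?thesis by blast
qed

section \<open>Assembly of the operator\<close>

theorem theorem1p4:
  fixes \<kappa> :: "'k rel"
    and i :: "'a::linorder_topology \<Rightarrow> 'b::t2_space"
  assumes "Card_order \<kappa>"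
    and "martins_axiom \<kappa>"
    and "compact (UNIV :: 'a set)"
    and "separable_space (euclidean :: 'a topology)"
    and "has_weight TYPE('a) \<kappa>"
    and "countable_discrete_extension i"
  shows "\<exists>E :: ('a \<Rightarrow>\<^sub>C real) \<Rightarrow>\<^sub>L ('b \<Rightarrow>\<^sub>C real). extension_operator i E \<and> norm E \<le> 3"
proof -
  define N where "N = - range i"
  interpret compact_line_extension i N
    using assms(3,6) by unfold_locales (simp_all add: N_def)
  obtain a b c where abc: "\<And>f :: 'a \<Rightarrow> real. continuous_on UNIV f \<Longrightarrow>
      continuous_on UNIV (\<lambda>y. if y \<in> N then f (a y) - f (b y) + f (c y) else f (inv i y))"
    using ex_evaluation_points[OF assms(1,2,5,4)] by blast
  define F where "F f y = (if y \<in> N then f (a y) - f (b y) + f (c y) else f (inv i y))"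
    for f :: "'a \<Rightarrow> real" and y
  define E where "E f = Bcontfun (F (apply_bcontfun f))" for f :: "'a \<Rightarrow>\<^sub>C real"
  \<comment> \<open>Three evaluations with coefficients of modulus one on \<open>N\<close>, a single
    one elsewhere.\<close>
  have bound: "norm (F (apply_bcontfun f) y) \<le> norm f * 3" for f y
    using norm_bounded[of f "a y"] norm_bounded[of f "b y"] norm_bounded[of f "c y"]
      norm_bounded[of f "inv i y"] norm_ge_zero[of f] unfolding F_def by auto
  have E: "apply_bcontfun (E f) y = F (apply_bcontfun f) y" for f y
  proof -
    \<comment> \<open>Continuity and boundedness are needed for \<open>Bcontfun\<close> to return
      the intended function.\<close>
    have "F (apply_bcontfun f) \<in> bcontfun"
      using abc[of "apply_bcontfun f"] bound[of f] unfolding F_def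
      by (intro bcontfun_normI[where b = "norm f * 3"]) auto
    then show ?thesis unfolding E_def by (simp add: Bcontfun_inverse)
  qed
  have normE: "norm (E f) \<le> norm f * 3" for f
    by (rule norm_bound) (use bound in \<open>simp add: E\<close>)
  have "bounded_linear E"
    by (rule bounded_linear_intro[OF _ _ normE])
      (auto intro!: bcontfun_eqI simp: E F_def algebra_simps)
  then have app: "blinfun_apply (Blinfun E) = E" by (rule bounded_linear_Blinfun_apply)
  have "extension_operator i (Blinfun E)"
    unfolding extension_operator_def app E F_def N_def using inj_i by simp
  moreover have "norm (Blinfun E) \<le> 3"
    by (rule norm_blinfun_bound) (use normE in \<open>simp_all add: app mult.commute\<close>)
  ultimately show ?thesis by blast
qed

end
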